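(* Let $k\ge 1$ be an integer. For $n\ge 2$ and $k\ge n-2$, we have $$C_n(x_1,x_2,\ldots,x_{k+1})=\sum\gamma(n;i_1,i_2,\ldots,i_n)\,e_{k-n+2}^{i_n}\,e_{k-n+3}^{i_{n-1}}\cdots e_k^{i_2}\,e_{k+1}^{i_1},$$ where the summation is over all sequences $(i_1,i_2,\ldots,i_n)$ of nonnegative integers such that $i_1+i_2+\cdots+i_n=n$, $1\le i_1\le n-1$, $i_n=0$ or $i_n=1$, and, when $i_n=1$, $i_1=n-1$. The coefficient $\gamma(n;i_1,i_2,\ldots,i_n)$ equals the number of 0-1-2-$\cdots$-$k$-$(k+1)$ increasing plane trees on $[n]$ with $i_j$ degree $j-1$ vertices for all $1\le j\le n$.
   Context: For positive integers $n,k$, $\mathcal{Q}_n(k)$ is the set of $k$-Stirling permutations of order $n$: words $\sigma=\sigma_1\cdots\sigma_{kn}$ that are arrangements of the multiset in which each of $1,\ldots,n$ appears $k$ times, such that all elements between two occurrences of $i$ are at least $i$, for each $i\in[n]=\{1,\ldots,n\}$. Set $\sigma_0=\sigma_{kn+1}=0$. An index $i\in\{0,1,\ldots,kn\}$ is an ascent (resp. descent, plateau) of $\sigma$ if $\sigma_i<\sigma_{i+1}$ (resp. $\sigma_i>\sigma_{i+1}$, $\sigma_i=\sigma_{i+1}$); $\mathrm{asc}(\sigma)$ and $\mathrm{des}(\sigma)$ are the numbers of ascents and descents. An index $i$ is a $j$-plateau if it is a plateau and there are exactly $j-1$ indices $\ell<i$ with $\sigma_\ell=\sigma_i$; $\mathrm{plat}_j(\sigma)$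 is the number of $j$-plateaux. The multivariate $k$-th order Eulerian polynomials are $$C_n(x_1,\ldots,x_{k+1})=\sum_{\sigma\in\mathcal{Q}_n(k)}x_1^{\mathrm{plat}_1(\sigma)}x_2^{\mathrm{plat}_2(\sigma)}\cdots x_{k-1}^{\mathrm{plat}_{k-1}(\sigma)}x_k^{\mathrm{des}(\sigma)}x_{k+1}^{\mathrm{asc}(\sigma)}.$$ $e_i$ denotes the $i$-th elementary symmetric function in the $k+1$ variables $x_1,\ldots,x_{k+1}$ (with $e_0=1$). An increasing plane tree on $[n]$ is a rooted tree with vertices labelled bijectively by $1,\ldots,n$, with root $1$, labels increasing along every path from the root, and the children of each vertex linearly ordered. The degree of a vertex is its number of children. A 0-1-2-$\cdots$-$k$-$(k+1)$ increasing plane tree is an increasing plane tree in which every vertex has at most $k+1$ children. *)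

theory Defs
  imports "HOL-Combinatorics.Multiset_Permutations" "HOL-Library.Poly_Mapping" "HOL-Library.FuncSet"
begin

definition stirling_perms :: "nat \<Rightarrow> nat \<Rightarrow> nat list set" where
  "stirling_perms k n =
     {\<sigma> \<in> permutations_of_multiset (\<Sum>i\<in>{1..n}. replicate_mset k i).
        \<forall>a b c. a < b \<longrightarrow> b < c \<longrightarrow> c < length \<sigma> \<longrightarrow> \<sigma> ! a = \<sigma> ! c \<longrightarrow> \<sigma> ! a \<le> \<sigma> ! b}"

text \<open>
  The word with the boundary convention \<open>\<sigma>\<^sub>0 = \<sigma>\<^sub>k\<^sub>n\<^sub>+\<^sub>1 = 0\<close>; since the letters of a word are numbered
  from 1, its position \<open>i\<close> in the padded list is exactly \<open>\<sigma>\<^sub>i\<close>.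
\<close>

definition padded :: "nat list \<Rightarrow> nat list" where
  "padded \<sigma> = 0 # \<sigma> @ [0]"

definition asc :: "nat list \<Rightarrow> nat" where
  "asc \<sigma> = card {i \<in> {0..length \<sigma>}. padded \<sigma> ! i < padded \<sigma> ! (i + 1)}"

definition des :: "nat list \<Rightarrow> nat" where
  "des \<sigma> = card {i \<in> {0..length \<sigma>}. padded \<sigma> ! i > padded \<sigma> ! (i + 1)}"

definition plat :: "nat \<Rightarrow> nat list \<Rightarrow> nat" where
  "plat j \<sigma> = card {i \<in> {0..length \<sigma>}. padded \<sigma> ! i = padded \<sigma> ! (i + 1) \<and>
                     card {l. l < i \<and> padded \<sigma> ! l = padded \<sigma> ! i} + 1 = j}"

text \<open>
  Integer polynomials in variables indexed by natural numbers: a polynomial maps each monomial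
  (a finitely supported exponent vector) to its coefficient.
\<close>

type_synonym int_mpoly = "(nat \<Rightarrow>\<^sub>0 nat) \<Rightarrow>\<^sub>0 int"

definition X :: "nat \<Rightarrow> int_mpoly" where
  "X i = Poly_Mapping.single (Poly_Mapping.single i 1) 1"

definition elem_sym :: "nat \<Rightarrow> nat \<Rightarrow> int_mpoly" where
  "elem_sym m i = (\<Sum>S | S \<subseteq> {1..m} \<and> card S = i. \<Prod>j\<in>S. X j)"

definition eulerian_poly :: "nat \<Rightarrow> nat \<Rightarrow> int_mpoly" where
  "eulerian_poly k n =
     (\<Sum>\<sigma>\<in>stirling_perms k n. (\<Prod>j=1..k-1. X j ^ plat j \<sigma>) * X k ^ des \<sigma> * X (k + 1) ^ asc \<sigma>)"

datatype ptree = Node (root_label: nat) (children: "ptree list")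

text \<open>
  A vertex is represented by the subtree rooted at it; this list has one entry per vertex.
\<close>

fun vertices :: "ptree \<Rightarrow> ptree list" where
  "vertices (Node a ts) = Node a ts # concat (map vertices ts)"

definition vdegree :: "ptree \<Rightarrow> nat" where
  "vdegree v = length (children v)"

definition increasing_plane_trees :: "nat \<Rightarrow> ptree set" where
  "increasing_plane_trees n =
     {t. distinct (map root_label (vertices t)) \<and> root_label ` set (vertices t) = {1..n} \<and>
         root_label t = 1 \<and>
         (\<forall>v\<in>set (vertices t). \<forall>c\<in>set (children v). root_label v < root_label c)}"

definition bounded_increasing_plane_trees :: "nat \<Rightarrow> nat \<Rightarrow> ptree set" where
  "bounded_increasing_plane_trees d n =
     {t \<in> increasing_plane_trees n. \<forall>v\<in>set (vertices t). vdegree v \<le> d}"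

definition num_of_degree :: "nat \<Rightarrow> ptree \<Rightarrow> nat" where
  "num_of_degree d t = length (filter (\<lambda>v. vdegree v = d) (vertices t))"

definition gamma_coeff :: "nat \<Rightarrow> nat \<Rightarrow> (nat \<Rightarrow> nat) \<Rightarrow> nat" where
  "gamma_coeff k n i =
     card {t \<in> bounded_increasing_plane_trees (k + 1) n. \<forall>j\<in>{1..n}. num_of_degree (j - 1) t = i j}"

text \<open>
  The sequences \<open>(i\<^sub>1, \<dots>, i\<^sub>n)\<close> are functions on \<open>{1..n}\<close>; extensionality makes each sequence
  occur exactly once.
\<close>

definition index_seqs :: "nat \<Rightarrow> (nat \<Rightarrow> nat) set" where
  "index_seqs n =
     {i \<in> {1..n} \<rightarrow>\<^sub>E UNIV. (\<Sum>j=1..n. i j) = n \<and> 1 \<le> i 1 \<and> i 1 \<le> n - 1 \<and>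
        (i n = 0 \<or> i n = 1) \<and> (i n = 1 \<longrightarrow> i 1 = n - 1)}"

end

theory Submission
  imports Defs "HOL-Library.Sublist"
begin

text \<open>
  Both sides of the identity satisfy the same differential recurrence. Let \<open>D\<close> be the derivation
  of the polynomial ring with \<open>D x\<^sub>j = x\<^sub>1 \<cdots> x\<^sub>k\<^sub>+\<^sub>1 = e\<^sub>k\<^sub>+\<^sub>1\<close> for all \<open>j\<close>.

  On the side of words, a Stirling permutation of order \<open>n + 1\<close> is obtained in exactly one way by
  inserting the block \<open>(n + 1)\<^sup>k\<close> into one of the \<open>kn + 1\<close> slots of a Stirling permutation of order
  \<open>n\<close>. The chosen slot, be it an ascent, a descent or a plateau, is replaced by one ascent, one
  descent and one \<open>j\<close>-plateau for each \<open>j < k\<close>, so that its variable is replaced by \<open>e\<^sub>k\<^sub>+\<^sub>1\<close>. The sum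
  over all slots is \<open>D\<close> applied to the monomial of the word, whence \<open>C\<^sub>n = D\<^sup>n x\<^sub>1\<close> for \<open>n \<ge> 1\<close>
  (\<open>eulerian_poly_eq_grammar_deriv\<close>).

  On elementary symmetric functions \<open>D e\<^sub>m = (k + 2 - m) e\<^sub>m\<^sub>-\<^sub>1 e\<^sub>k\<^sub>+\<^sub>1\<close>. With \<open>a\<^sub>d = e\<^sub>k\<^sub>+\<^sub>1\<^sub>-\<^sub>d\<close> this reads
  \<open>D a\<^sub>d = (d + 1) a\<^sub>d\<^sub>+\<^sub>1 a\<^sub>0\<close> (\<open>grammar_deriv_degree_weight\<close>), which is the effect of attaching a
  new leaf to a vertex with \<open>d\<close> ordered children in one of the \<open>d + 1\<close> possible places. Since every
  increasing plane tree on \<open>[n + 1]\<close> arises once by adding the leaf \<open>n + 1\<close> to a tree on \<open>[n]\<close>, the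
  sum over all increasing plane trees on \<open>[n]\<close> of the product of the \<open>a\<^sub>d\<close> over the vertex degrees
  \<open>d\<close> is again \<open>D\<^sup>n x\<^sub>1\<close> (\<open>tree_weight_sum\<close>).

  It remains to collect the trees with equal degree sequence. That these sequences belong to the
  stated index set follows from the degrees having sum \<open>n - 1\<close>
  (\<open>degree_seq_in_index_seqs\<close>); that the bound \<open>k + 1\<close> on the degrees excludes no tree follows
  from \<open>k \<ge> n - 2\<close>.
\<close>

section \<open>A derivation on integer polynomials\<close>

text \<open>
  This is the operator \<open>x\<^sub>1 \<cdots> x\<^sub>k\<^sub>+\<^sub>1 (\<partial>\<^sub>1 + \<cdots> + \<partial>\<^sub>k\<^sub>+\<^sub>1)\<close>. An integer polynomial is
  an element of the free abelian group on its monomials, so the partial derivatives are given on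
  monomials and extended linearly. For \<open>m\<close> without the variable \<open>i\<close> the truncated difference
  \<open>m - single i 1\<close> is the wrong monomial, but its coefficient is then zero.
\<close>

definition grammar_deriv :: "nat \<Rightarrow> int_mpoly \<Rightarrow> int_mpoly" where
  "grammar_deriv k p =
     (\<Prod>j=1..k+1. X j) *
     frag_extend (\<lambda>m. \<Sum>i=1..k+1. of_nat (Poly_Mapping.lookup m i) * frag_of (m - Poly_Mapping.single i 1)) p"

lemma grammar_deriv_diff: "grammar_deriv k (p - q) = grammar_deriv k p - grammar_deriv k q"
  by (simp add: grammar_deriv_def frag_extend_diff algebra_simps)

lemma grammar_deriv_add: "grammar_deriv k (p + q) = grammar_deriv k p + grammar_deriv k q"
  by (simp add: grammar_deriv_def frag_extend_add algebra_simps)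

lemma grammar_deriv_0 [simp]: "grammar_deriv k 0 = 0"
  by (simp add: grammar_deriv_def)

lemma frag_of_mult: "frag_of a * frag_of b = (frag_of (a + b) :: int_mpoly)"
  by (simp add: mult_single)

lemma grammar_deriv_frag_of_mult:
  "grammar_deriv k (frag_of a * frag_of b) =
     grammar_deriv k (frag_of a) * frag_of b + frag_of a * grammar_deriv k (frag_of b)"
proof -
  have shift: "of_nat (Poly_Mapping.lookup c i) * frag_of (c + d - Poly_Mapping.single i 1) =
      of_nat (Poly_Mapping.lookup c i) * (frag_of (c - Poly_Mapping.single i 1) * frag_of d :: int_mpoly)"
    for c d :: "nat \<Rightarrow>\<^sub>0 nat" and i
  proof (cases "Poly_Mapping.lookup c i = 0")
    case False
    have "c + d - Poly_Mapping.single i 1 = (c - Poly_Mapping.single i 1) + d"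
      using False by (intro poly_mapping_eqI) (auto simp: lookup_add lookup_minus lookup_single when_def)
    then show ?thesis by (simp add: frag_of_mult)
  qed simp
  have term_eq: "of_nat (Poly_Mapping.lookup (a + b) i) * frag_of (a + b - Poly_Mapping.single i 1) =
      of_nat (Poly_Mapping.lookup a i) * frag_of (a - Poly_Mapping.single i 1) * frag_of b +
      frag_of a * (of_nat (Poly_Mapping.lookup b i) * frag_of (b - Poly_Mapping.single i 1) :: int_mpoly)" for i
  proof -
    have "of_nat (Poly_Mapping.lookup (a + b) i) * frag_of (a + b - Poly_Mapping.single i 1) =
      of_nat (Poly_Mapping.lookup a i) * frag_of (a + b - Poly_Mapping.single i 1) +
      of_nat (Poly_Mapping.lookup b i) * (frag_of (b + a - Poly_Mapping.single i 1) :: int_mpoly)"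
      by (simp add: lookup_add distrib_right add.commute[of b a])
    then show ?thesis
      unfolding shift by (simp only: mult_ac)
  qed
  show ?thesis
    by (simp add: frag_of_mult grammar_deriv_def term_eq sum.distrib sum_distrib_left sum_distrib_right
        distrib_left mult_ac del: One_nat_def)
qed

text \<open>
  Both sides of the product rule are bilinear, so it suffices to know it for two monomials.
\<close>

lemma grammar_deriv_mult:
  "grammar_deriv k (p * q) = grammar_deriv k p * q + p * grammar_deriv k q"
proof -
  have one: "grammar_deriv k (frag_of a * q) = grammar_deriv k (frag_of a) * q + frag_of a * grammar_deriv k q"
    for a
  proof (rule frag_induction[of q UNIV], goal_cases)
    case (4 c d)
    then show ?case by (simp add: grammar_deriv_diff algebra_simps)
  qed (simp_all add: grammar_deriv_frag_of_mult)
  show ?thesis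
  proof (rule frag_induction[of p UNIV], goal_cases)
    case (4 c d)
    then show ?case by (simp add: grammar_deriv_diff algebra_simps)
  qed (simp_all add: one)
qed

lemma grammar_deriv_1 [simp]: "grammar_deriv k 1 = 0"
  using grammar_deriv_mult[of k 1 1] by simp

lemma grammar_deriv_sum: "grammar_deriv k (\<Sum>a\<in>A. f a) = (\<Sum>a\<in>A. grammar_deriv k (f a))"
  by (induction A rule: infinite_finite_induct) (simp_all add: grammar_deriv_add)

lemma grammar_deriv_X:
  assumes "j \<in> {1..k+1}"
  shows "grammar_deriv k (X j) = (\<Prod>j=1..k+1. X j)"
proof -
  have "X j = frag_of (Poly_Mapping.single j 1)"
    by (simp add: X_def)
  moreover have "(\<Sum>i=1..k+1. of_nat (Poly_Mapping.lookup (Poly_Mapping.single j 1) i) *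
      frag_of (Poly_Mapping.single j 1 - Poly_Mapping.single i 1)) = (1 :: int_mpoly)"
  proof -
    have "(\<Sum>i=1..k+1. of_nat (Poly_Mapping.lookup (Poly_Mapping.single j 1) i) *
      frag_of (Poly_Mapping.single j 1 - Poly_Mapping.single i 1)) = 
      (\<Sum>i=1..k+1. if i = j then 1 else (0 :: int_mpoly))"
      by (intro sum.cong) (auto simp: lookup_single when_def)
    then show ?thesis using assms by simp
  qed
  ultimately show ?thesis
    by (simp add: grammar_deriv_def del: One_nat_def)
qed

lemma grammar_deriv_prod_X:
  assumes "finite S" "S \<subseteq> {1..k+1}"
  shows "grammar_deriv k (\<Prod>j\<in>S. X j) = (\<Prod>j=1..k+1. X j) * (\<Sum>j\<in>S. \<Prod>l\<in>S - {j}. X l)"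
  using assms
proof (induction S)
  case (insert a S)
  have "(\<Sum>j\<in>S. \<Prod>l\<in>insert a S - {j}. X l) = X a * (\<Sum>j\<in>S. \<Prod>l\<in>S - {j}. X l)"
    unfolding sum_distrib_left
  proof (intro sum.cong refl)
    fix j assume "j \<in> S"
    then have "insert a S - {j} = insert a (S - {j})" using insert.hyps by auto
    then show "(\<Prod>l\<in>insert a S - {j}. X l) = X a * (\<Prod>l\<in>S - {j}. X l)"
      using insert.hyps by simp
  qed
  then show ?case
    using insert by (simp add: grammar_deriv_mult grammar_deriv_X algebra_simps del: One_nat_def)
qed simp

text \<open>
  Differentiating deletes one element \<open>j\<close> of an index set \<open>S\<close> of size \<open>m + 1\<close>. A set of size
  \<open>m\<close> arises in this way once for each of the \<open>k + 1 - m\<close> indices that it does not contain.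
\<close>

lemma grammar_deriv_elem_sym:
  assumes "m \<le> k"
  shows "grammar_deriv k (elem_sym (k + 1) (Suc m)) =
    of_nat (k + 1 - m) * elem_sym (k + 1) m * (\<Prod>j=1..k+1. X j)"
proof -
  let ?V = "{1..k+1}"
  let ?A = "Sigma {S. S \<subseteq> ?V \<and> card S = Suc m} (\<lambda>S. S)"
  let ?B = "Sigma {S. S \<subseteq> ?V \<and> card S = m} (\<lambda>S. ?V - S)"
  have fin: "finite S" if "S \<subseteq> ?V" for S using that finite_subset by blast
  have fins: "finite {S. S \<subseteq> ?V \<and> card S = c}" for c
    by (rule finite_subset[of _ "Pow ?V"]) auto
  have bij: "bij_betw (\<lambda>(S, j). (S - {j}, j)) ?A ?B"
  proof (rule bij_betw_byWitness[where f' = "\<lambda>(S, j). (insert j S, j)"])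
    show "(\<lambda>(S, j). (S - {j}, j)) ` ?A \<subseteq> ?B"
      by (auto simp del: One_nat_def)
    show "(\<lambda>(S, j). (insert j S, j)) ` ?B \<subseteq> ?A"
      using fin by (auto simp del: One_nat_def)
  qed auto
  have "(\<Sum>S | S \<subseteq> ?V \<and> card S = Suc m. \<Sum>j\<in>S. \<Prod>l\<in>S - {j}. X l) =
        (\<Sum>(S, j)\<in>?A. \<Prod>l\<in>S - {j}. X l)"
    using fin fins by (subst sum.Sigma) auto
  also have "\<dots> = (\<Sum>(S, j)\<in>?B. \<Prod>l\<in>S. X l)"
    using sum.reindex_bij_betw[OF bij, of "\<lambda>(S, j). \<Prod>l\<in>S. X l"]
    by (simp add: case_prod_unfold)
  also have "\<dots> = (\<Sum>S | S \<subseteq> ?V \<and> card S = m. \<Sum>j\<in>?V - S. \<Prod>l\<in>S. X l)"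
    using fins by (subst sum.Sigma) auto
  also have "\<dots> = (\<Sum>S | S \<subseteq> ?V \<and> card S = m. of_nat (k + 1 - m) * (\<Prod>l\<in>S. X l))"
    using fin by (intro sum.cong) (auto simp: card_Diff_subset simp del: One_nat_def)
  finally have count: "(\<Sum>S | S \<subseteq> ?V \<and> card S = Suc m. \<Sum>j\<in>S. \<Prod>l\<in>S - {j}. X l) =
     of_nat (k + 1 - m) * elem_sym (k + 1) m"
    by (simp add: elem_sym_def sum_distrib_left)
  have "grammar_deriv k (elem_sym (k + 1) (Suc m)) =
      (\<Sum>S | S \<subseteq> ?V \<and> card S = Suc m. (\<Prod>j=1..k+1. X j) * (\<Sum>j\<in>S. \<Prod>l\<in>S - {j}. X l))"
    unfolding elem_sym_def grammar_deriv_sum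
    by (intro sum.cong refl grammar_deriv_prod_X) (use fin in auto)
  then show ?thesis
    using count by (simp add: sum_distrib_left[symmetric] mult_ac)
qed

text \<open>
  The weight of a tree vertex with \<open>d\<close> children. Extending it by zero beyond \<open>k + 1\<close>, where
  the truncated index \<open>k + 1 - d\<close> would give \<open>e\<^sub>0 = 1\<close>, makes the rule for its derivative uniform in \<open>d\<close>.
\<close>

definition degree_weight :: "nat \<Rightarrow> nat \<Rightarrow> int_mpoly" where
  "degree_weight k d = (if d \<le> k + 1 then elem_sym (k + 1) (k + 1 - d) else 0)"

lemma elem_sym_0: "elem_sym m 0 = 1"
proof -
  have "{S. S \<subseteq> {1..m} \<and> card S = 0} = {{}}"
    using finite_subset[of _ "{1..m}"] by auto
  then show ?thesis by (simp add: elem_sym_def)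
qed

lemma elem_sym_full: "elem_sym m m = (\<Prod>j=1..m. X j)"
proof -
  have "{S. S \<subseteq> {1..m} \<and> card S = m} = {{1..m}}"
    using card_subset_eq[of "{1..m}"] by auto
  then show ?thesis by (simp add: elem_sym_def)
qed

lemma degree_weight_0: "degree_weight k 0 = (\<Prod>j=1..k+1. X j)"
  by (simp only: degree_weight_def elem_sym_full le0 if_True diff_zero)

text \<open>
  This rule describes how a new leaf is attached to a vertex with \<open>d\<close> children: there are
  \<open>d + 1\<close> places among the children, the vertex gets one more child, and a vertex of degree 0
  appears. At \<open>d = k + 1\<close> both sides vanish, because \<open>e\<^sub>0 = 1\<close>.
\<close>

lemma grammar_deriv_degree_weight:
  "grammar_deriv k (degree_weight k d) =
     of_nat (Suc d) * degree_weight k (Suc d) * degree_weight k 0"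
proof (cases "d \<le> k")
  case True
  then have "k + 1 - d = Suc (k - d)" "k + 1 - (k - d) = Suc d" by simp_all
  with True show ?thesis
    using grammar_deriv_elem_sym[of "k - d" k] unfolding degree_weight_0
    by (simp add: degree_weight_def)
next
  case False
  then show ?thesis
    by (cases "d = Suc k") (simp_all add: degree_weight_def elem_sym_0)
qed

section \<open>Stirling permutations and insertion of a maximal block\<close>

text \<open>
  The variable contributed by two adjacent letters \<open>a\<close>, \<open>b\<close>, where \<open>h\<close> collects the letters to
  the left of this occurrence of \<open>a\<close>; in a plateau, \<open>h\<close> tells which occurrence of \<open>a\<close> it is.
\<close>

definition slot_weight :: "nat \<Rightarrow> nat multiset \<Rightarrow> nat \<Rightarrow> nat \<Rightarrow> int_mpoly" where
  "slot_weight k h a b = (if a < b then X (k + 1) else if b < a then X k else X (Suc (count h a)))"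

text \<open>
  The product of the variables of all slots of \<open>p\<close>, for a word \<open>p\<close> that continues letters \<open>h\<close>
  read before it. Carrying \<open>h\<close> along lets insertion be analysed by recursion on the word.
\<close>

fun word_weight :: "nat \<Rightarrow> nat multiset \<Rightarrow> nat list \<Rightarrow> int_mpoly" where
  "word_weight k h (a # b # p) = slot_weight k h a b * word_weight k (add_mset a h) (b # p)"
| "word_weight k h p = 1"

definition insert_block :: "nat \<Rightarrow> nat \<Rightarrow> nat \<Rightarrow> nat list \<Rightarrow> nat list" where
  "insert_block k N i \<sigma> = take i \<sigma> @ replicate k N @ drop i \<sigma>"

lemma word_weight_fresh:
  "N \<notin> set p \<Longrightarrow> word_weight k (h + replicate_mset m N) p = word_weight k h p"
  by (induction k h p rule: word_weight.induct) (auto simp: slot_weight_def)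

text \<open>
  A block of \<open>m + 1\<close> equal letters has \<open>m\<close> plateaux, whose indices continue the count of \<open>N\<close>
  in \<open>h\<close>, followed by one descent; the letters after it do not see the \<open>N\<close>s read before.
\<close>

lemma word_weight_block_start:
  assumes "b < N" "N \<notin> set p"
  shows "word_weight k h (replicate (Suc m) N @ b # p) =
    (\<Prod>j=Suc (count h N)..count h N + m. X j) * X k * word_weight k h (b # p)"
proof (induction m arbitrary: h)
  case 0
  have "word_weight k (h + replicate_mset 1 N) (b # p) = word_weight k h (b # p)"
    using assms by (intro word_weight_fresh) auto
  then show ?case using assms by (simp add: slot_weight_def)
next
  case (Suc m)
  have "word_weight k (h + replicate_mset 1 N) (b # p) = word_weight k h (b # p)"
    using assms by (intro word_weight_fresh) auto
  moreover have "(\<Prod>j=Suc (count h N)..Suc (count h N + m). X j) =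
      X (Suc (count h N)) * (\<Prod>j=Suc (Suc (count h N))..Suc (count h N + m). X j)"
    by (rule prod.atLeast_Suc_atMost) simp
  ultimately show ?case
    using Suc[of "add_mset N h"] by (simp add: slot_weight_def mult_ac)
qed

text \<open>
  The reason for the derivation: a block \<open>N\<^sup>k\<close> of a new maximal letter replaces one slot by an
  ascent, the \<open>k - 1\<close> plateaux with indices \<open>1, \<dots>, k - 1\<close> and a descent, hence by the product of
  all variables, whatever the slot was, and leaves the other slots alone.
\<close>

lemma word_weight_block:
  assumes "k \<ge> 1" "a < N" "b < N" "N \<notin> set p" "count h N = 0"
  shows "word_weight k h (a # replicate k N @ b # p) =
    (\<Prod>j=1..k+1. X j) * word_weight k (add_mset a h) (b # p)"
proof -
  obtain m where k: "k = Suc m" using assms(1) by (cases k) auto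
  show ?thesis
    using word_weight_block_start[OF assms(3,4), of k "add_mset a h" m] assms
    by (simp add: k slot_weight_def mult_ac)
qed

text \<open>
  The bound on the count keeps the index of a plateau within \<open>{1..k}\<close>, among the variables on which
  the derivation acts.
\<close>

lemma grammar_deriv_slot_weight:
  assumes "k \<ge> 1" "a = b \<Longrightarrow> count h a + 1 \<le> k"
  shows "grammar_deriv k (slot_weight k h a b) = (\<Prod>j=1..k+1. X j)"
  using assms unfolding slot_weight_def by (auto intro!: grammar_deriv_X[unfolded atLeastAtMost_iff] simp del: One_nat_def)

text \<open>
  By the product rule the derivation replaces the slots one at a time, which is what inserting the
  block at each inner position does. Multiplicity \<open>k + 1\<close> rather than \<open>k\<close> is admitted because
  the padding letter 0 occurs twice, which matters for \<open>k = 1\<close>.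
\<close>

lemma grammar_deriv_word_weight:
  assumes "k \<ge> 1" "\<And>x. count (h + mset p) x \<le> k + 1" "\<And>x. x \<in> set p \<Longrightarrow> x < N" "count h N = 0"
  shows "grammar_deriv k (word_weight k h p) =
    (\<Sum>i=1..<length p. word_weight k h (insert_block k N i p))"
  using assms
proof (induction k h p rule: word_weight.induct)
  case (1 k h a b p)
  have "grammar_deriv k (slot_weight k h a b) = (\<Prod>j=1..k+1. X j)"
  proof (rule grammar_deriv_slot_weight)
    show "count h a + 1 \<le> k" if "a = b" using "1.prems"(2)[of a] that by simp
  qed fact
  moreover have "grammar_deriv k (word_weight k (add_mset a h) (b # p)) =
      (\<Sum>i=1..<length (b # p). word_weight k (add_mset a h) (insert_block k N i (b # p)))"
  proof (rule "1.IH")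
    show "count (add_mset a h + mset (b # p)) x \<le> k + 1" for x
      using "1.prems"(2)[of x] by (auto split: if_splits)
    show "count (add_mset a h) N = 0" using "1.prems" by (auto)
  qed (use "1.prems" in auto)
  \<comment> \<open>The slot between \<open>a\<close> and \<open>b\<close> is the first summand; all others lie in the rest of the word.\<close>
  moreover have "(\<Sum>i=1..<length (a # b # p). word_weight k h (insert_block k N i (a # b # p))) =
      word_weight k h (insert_block k N 1 (a # b # p)) +
      (\<Sum>i=1..<length (b # p). word_weight k h (insert_block k N (Suc i) (a # b # p)))"
    by (simp add: sum.atLeast_Suc_lessThan sum.shift_bounds_Suc_ivl
        del: sum.op_ivl_Suc)
  moreover have "word_weight k h (insert_block k N 1 (a # b # p)) =
      (\<Prod>j=1..k+1. X j) * word_weight k (add_mset a h) (b # p)"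
    using word_weight_block[of k a N b p h] "1.prems" by (auto simp: insert_block_def)
  moreover have "(\<Sum>i=1..<length (b # p). word_weight k h (insert_block k N (Suc i) (a # b # p))) =
      slot_weight k h a b *
        (\<Sum>i=1..<length (b # p). word_weight k (add_mset a h) (insert_block k N i (b # p)))"
    unfolding sum_distrib_left
  proof (intro sum.cong refl)
    fix i assume "i \<in> {1..<length (b # p)}"
    then obtain l where "i = Suc l" by (cases i) auto
    then show "word_weight k h (insert_block k N (Suc i) (a # b # p)) =
      slot_weight k h a b * word_weight k (add_mset a h) (insert_block k N i (b # p))"
      by (simp add: insert_block_def)
  qed
  ultimately show ?case
    by (simp only: word_weight.simps grammar_deriv_mult)
qed simp_all

lemma grammar_deriv_padded_weight:
  assumes "k \<ge> 1" "\<And>x. count (mset (padded \<sigma>)) x \<le> k + 1" "\<And>x. x \<in> set \<sigma> \<Longrightarrow> x < N" "0 < N"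
  shows "grammar_deriv k (word_weight k {#} (padded \<sigma>)) =
    (\<Sum>i=0..length \<sigma>. word_weight k {#} (padded (insert_block k N i \<sigma>)))"
proof -
  have "grammar_deriv k (word_weight k {#} (padded \<sigma>)) =
    (\<Sum>i=1..<length (padded \<sigma>). word_weight k {#} (insert_block k N i (padded \<sigma>)))"
    using assms by (intro grammar_deriv_word_weight) (auto simp: padded_def)
  also have "\<dots> = (\<Sum>i=Suc 0..<Suc (Suc (length \<sigma>)). word_weight k {#} (insert_block k N i (padded \<sigma>)))"
    by (simp add: padded_def del: sum.op_ivl_Suc)
  also have "\<dots> = (\<Sum>i=0..<Suc (length \<sigma>). word_weight k {#} (insert_block k N (Suc i) (padded \<sigma>)))"
    by (rule sum.shift_bounds_Suc_ivl)
  also have "\<dots> = (\<Sum>i=0..length \<sigma>. word_weight k {#} (padded (insert_block k N i \<sigma>)))"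
    by (intro sum.cong) (auto simp: insert_block_def padded_def)
  finally show ?thesis .
qed

lemma subseq3_iff_nth:
  "subseq [x, y, z] w \<longleftrightarrow>
     (\<exists>a b c. a < b \<and> b < c \<and> c < length w \<and> w ! a = x \<and> w ! b = y \<and> w ! c = z)"
proof
  assume "subseq [x, y, z] w"
  then obtain u1 v1 where w: "w = u1 @ x # v1" "subseq [y, z] v1"
    by (blast dest: list_emb_ConsD)
  from w(2) obtain u2 v2 where v1: "v1 = u2 @ y # v2" "subseq [z] v2"
    by (blast dest: list_emb_ConsD)
  from v1(2) obtain u3 v3 where v2: "v2 = u3 @ z # v3"
    by (blast dest: list_emb_ConsD)
  show "\<exists>a b c. a < b \<and> b < c \<and> c < length w \<and> w ! a = x \<and> w ! b = y \<and> w ! c = z"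
    by (rule exI[of _ "length u1"], rule exI[of _ "Suc (length u1 + length u2)"],
        rule exI[of _ "Suc (Suc (length u1 + length u2 + length u3))"])
      (auto simp: w v1 v2 nth_append)
next
  assume "\<exists>a b c. a < b \<and> b < c \<and> c < length w \<and> w ! a = x \<and> w ! b = y \<and> w ! c = z"
  then obtain a b c where abc: "a < b" "b < c" "c < length w" "w ! a = x" "w ! b = y" "w ! c = z"
    by blast
  have w: "w = take b w @ y # drop (Suc b) w"
    using abc by (metis id_take_nth_drop less_trans)
  have "x \<in> set (take b w)"
    using abc by (auto simp: in_set_conv_nth intro!: exI[of _ a])
  moreover have "z \<in> set (drop (Suc b) w)"
    using abc by (auto simp: in_set_conv_nth intro!: exI[of _ "c - Suc b"])
  ultimately have "subseq ([x] @ [y] @ [z]) (take b w @ [y] @ drop (Suc b) w)"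
    by (intro list_emb_append_mono) (simp_all add: subseq_singleton_left)
  then show "subseq [x, y, z] w" using w by simp
qed

text \<open>
  In this form the Stirling condition is visibly inherited by subwords, and it can be tested after
  filtering letters, so no bookkeeping of positions is needed for insertion and deletion.
\<close>

lemma in_stirling_perms_iff:
  "\<sigma> \<in> stirling_perms k n \<longleftrightarrow>
     mset \<sigma> = (\<Sum>i\<in>{1..n}. replicate_mset k i) \<and> (\<forall>x y. subseq [x, y, x] \<sigma> \<longrightarrow> x \<le> y)"
  unfolding stirling_perms_def subseq3_iff_nth permutations_of_multiset_def mem_Collect_eq by metis

lemma stirling_multiset_Suc:
  fixes n :: nat
  shows "(\<Sum>i\<in>{1..Suc n}. replicate_mset k i) = (\<Sum>i\<in>{1..n}. replicate_mset k i) + replicate_mset k (Suc n)"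
  by simp

lemma count_stirling_multiset:
  fixes n :: nat
  shows "count (\<Sum>i\<in>{1..n}. replicate_mset k i) x = (if x \<in> {1..n} then k else 0)"
  by (induction n) auto

lemma count_stirling_perm:
  "\<sigma> \<in> stirling_perms k n \<Longrightarrow> count (mset \<sigma>) x = (if x \<in> {1..n} then k else 0)"
  by (simp only: in_stirling_perms_iff count_stirling_multiset)

lemma set_stirling_perm: "\<sigma> \<in> stirling_perms k n \<Longrightarrow> set \<sigma> \<subseteq> {1..n}"
  using count_stirling_perm[of \<sigma> k n] by (metis count_mset_0_iff subsetI)

lemma length_stirling_perm: "\<sigma> \<in> stirling_perms k n \<Longrightarrow> length \<sigma> = k * n"
proof -
  have "size (\<Sum>i\<in>{1..n}. replicate_mset k i) = k * n"
    by (induction n) auto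
  then show "\<sigma> \<in> stirling_perms k n \<Longrightarrow> length \<sigma> = k * n"
    by (metis in_stirling_perms_iff size_mset)
qed

lemma filter_insert_block:
  assumes "N \<notin> set \<sigma>"
  shows "filter (\<lambda>x. x \<noteq> N) (insert_block k N i \<sigma>) = \<sigma>"
proof -
  have "filter (\<lambda>x. x \<noteq> N) \<sigma> = \<sigma>"
    unfolding filter_id_conv using assms by auto
  then have "filter (\<lambda>x. x \<noteq> N) (take i \<sigma>) @ filter (\<lambda>x. x \<noteq> N) (drop i \<sigma>) = \<sigma>"
    by (metis append_take_drop_id filter_append)
  then show ?thesis by (simp add: insert_block_def)
qed

lemma insert_block_in_stirling_perms:
  assumes \<sigma>: "\<sigma> \<in> stirling_perms k n"
  shows "insert_block k (Suc n) i \<sigma> \<in> stirling_perms k (Suc n)"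
  unfolding in_stirling_perms_iff
proof (intro conjI allI impI)
  let ?N = "Suc n"
  have N: "?N \<notin> set \<sigma>" using set_stirling_perm[OF \<sigma>] by auto
  have "mset (insert_block k ?N i \<sigma>) = mset (take i \<sigma> @ drop i \<sigma>) + replicate_mset k ?N"
    unfolding insert_block_def mset_append by (simp add: ac_simps)
  then show "mset (insert_block k ?N i \<sigma>) = (\<Sum>i\<in>{1..?N}. replicate_mset k i)"
    using \<sigma> unfolding stirling_multiset_Suc in_stirling_perms_iff by simp
  fix x y assume sub: "subseq [x, y, x] (insert_block k ?N i \<sigma>)"
  have "x \<in> set (insert_block k ?N i \<sigma>)"
    using list_emb_ConsD[OF sub] by auto
  then have "x \<in> set \<sigma> \<or> x = ?N"
    by (auto simp: insert_block_def dest: in_set_takeD in_set_dropD)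
  then have "x \<le> ?N" using set_stirling_perm[OF \<sigma>] by auto
  consider "x = ?N" | "x \<noteq> ?N" "y = ?N" | "x \<noteq> ?N" "y \<noteq> ?N" by blast
  then show "x \<le> y"
  proof cases
    case 1
    have "?N \<notin> set (take i \<sigma>)" "?N \<notin> set (drop i \<sigma>)"
      using N by (auto dest: in_set_takeD in_set_dropD)
    moreover from sub obtain u v where uv: "[x, y, x] = u @ v"
        "subseq u (take i \<sigma>)" "subseq v (replicate k ?N @ drop i \<sigma>)"
      unfolding insert_block_def by (rule subseq_appendE)
    ultimately have "u = []" using 1 by (cases u) (auto dest!: list_emb_ConsD)
    then have "subseq [x, y, x] (replicate k ?N @ drop i \<sigma>)" using uv by simp
    then obtain u v where uv: "[x, y, x] = u @ v"
        "subseq u (replicate k ?N)" "subseq v (drop i \<sigma>)"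
      by (rule subseq_appendE)
    have "x \<notin> set v"
      using \<open>?N \<notin> set (drop i \<sigma>)\<close> 1 uv(3) by (auto elim: list_emb_set)
    then have "v = []" using uv(1) by (cases v rule: rev_cases) auto
    then have "y \<in> set (replicate k ?N)"
      using uv list_emb_set[of "(=)" "[x, y, x]" "replicate k ?N" y] by auto
    then show ?thesis using 1 by auto
  next
    case 2 then show ?thesis using \<open>x \<le> ?N\<close> by simp
  next
    case 3
    then have "subseq [x, y, x] \<sigma>"
      using subseq_filter[OF sub, of "\<lambda>x. x \<noteq> ?N"] filter_insert_block[OF N] by simp
    then show ?thesis using \<sigma> by (auto simp: in_stirling_perms_iff)
  qed
qed

text \<open>
  The copies of the largest letter are adjacent: a letter between two of them would have to be at
  least as large.
\<close>

lemma stirling_perm_is_insert_block: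
  assumes \<tau>: "\<tau> \<in> stirling_perms k (Suc n)"
  obtains \<sigma> i where "\<sigma> \<in> stirling_perms k n" "i \<le> length \<sigma>" "\<tau> = insert_block k (Suc n) i \<sigma>"
proof -
  let ?N = "Suc n"
  \<comment> \<open>\<open>v\<close> is the first run of the largest letter, and the point is that \<open>w\<close> contains no further copy.\<close>
  define u where "u = takeWhile (\<lambda>x. x \<noteq> ?N) \<tau>"
  define r where "r = dropWhile (\<lambda>x. x \<noteq> ?N) \<tau>"
  define v where "v = takeWhile (\<lambda>x. x = ?N) r"
  define w where "w = dropWhile (\<lambda>x. x = ?N) r"
  have \<tau>_eq: "\<tau> = u @ v @ w" by (simp add: u_def r_def v_def w_def)
  have u: "?N \<notin> set u" unfolding u_def by (metis set_takeWhileD)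
  have vN: "x = ?N" if "x \<in> set v" for x
    using that by (auto simp: v_def dest: set_takeWhileD)
  have v: "v = replicate (length v) ?N"
    by (rule replicate_eqI) (simp_all add: vN)
  have w: "?N \<notin> set w"
  proof
    assume "?N \<in> set w"
    then obtain y w' where w_eq: "w = y # w'" by (cases w) auto
    then have y: "y \<noteq> ?N" using hd_dropWhile[of "\<lambda>x. x = ?N" r] by (simp add: w_def)
    then have w': "?N \<in> set w'" using \<open>?N \<in> set w\<close> w_eq by simp
    have "v \<noteq> []"
    proof
      assume "v = []"
      then have "r = w" using takeWhile_dropWhile_id[of "\<lambda>x. x = ?N" r] unfolding v_def w_def by simp
      then have "hd r \<noteq> ?N" "r \<noteq> []" using y w_eq by auto
      then show False using w_eq y \<open>?N \<in> set w\<close> hd_dropWhile[of "\<lambda>x. x \<noteq> ?N" \<tau>] by (simp add: r_def)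
    qed
    then have "?N \<in> set (u @ v)" using vN[of "hd v"] hd_in_set[of v] by auto
    then have "subseq ([?N] @ [y] @ [?N]) ((u @ v) @ [y] @ w')"
      using w' by (intro list_emb_append_mono) (simp_all add: subseq_singleton_left)
    then have "?N \<le> y" using \<tau> \<tau>_eq w_eq by (auto simp: in_stirling_perms_iff)
    moreover have "y \<in> set \<tau>" using \<tau>_eq w_eq by simp
    ultimately show False using set_stirling_perm[OF \<tau>] y by auto
  qed
  have "count (mset \<tau>) ?N = length v"
  proof -
    have "count (mset u) ?N = 0" "count (mset w) ?N = 0" using u w by (simp_all add: count_mset_0_iff)
    moreover have "count (mset v) ?N = length v" by (subst v) simp
    ultimately show ?thesis by (simp add: \<tau>_eq)
  qed
  then have "length v = k" using count_stirling_perm[OF \<tau>] by simp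
  then have vk: "v = replicate k ?N" using v by simp
  have \<tau>_ins: "\<tau> = insert_block k ?N (length u) (u @ w)"
    by (simp add: insert_block_def \<tau>_eq vk)
  moreover have "u @ w \<in> stirling_perms k n"
    unfolding in_stirling_perms_iff
  proof (intro conjI allI impI)
    have "mset \<tau> = mset (u @ w) + replicate_mset k ?N"
      by (simp add: \<tau>_eq vk)
    then show "mset (u @ w) = (\<Sum>i\<in>{1..n}. replicate_mset k i)"
      using \<tau> unfolding in_stirling_perms_iff stirling_multiset_Suc by simp
    fix x y assume "subseq [x, y, x] (u @ w)"
    moreover have "subseq (u @ w) \<tau>" unfolding \<tau>_eq by (simp add: list_emb_append2 subseq_append')
    ultimately show "x \<le> y" using \<tau> by (meson in_stirling_perms_iff subseq_order.trans)
  qed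
  ultimately show ?thesis using that[of "u @ w" "length u"] by simp
qed

text \<open>
  Deleting the largest letter recovers the smaller word, and the prefix before its first occurrence
  recovers the position; this needs the block to be nonempty.
\<close>

lemma bij_betw_insert_block:
  assumes "k \<ge> 1"
  shows "bij_betw (\<lambda>(\<sigma>, i). insert_block k (Suc n) i \<sigma>)
    (stirling_perms k n \<times> {0..k * n}) (stirling_perms k (Suc n))"
  unfolding bij_betw_def
proof
  let ?N = "Suc n"
  have recover: "\<sigma> = filter (\<lambda>x. x \<noteq> ?N) \<tau> \<and> i = length (takeWhile (\<lambda>x. x \<noteq> ?N) \<tau>)"
    if "\<sigma> \<in> stirling_perms k n" "i \<le> k * n" "\<tau> = insert_block k ?N i \<sigma>" for \<sigma> i \<tau>
  proof
    have N: "?N \<notin> set \<sigma>" using set_stirling_perm[OF that(1)] by auto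
    then show "\<sigma> = filter (\<lambda>x. x \<noteq> ?N) \<tau>" using that filter_insert_block by simp
    obtain m where "k = Suc m" using assms by (cases k) auto
    moreover have "\<forall>x\<in>set (take i \<sigma>). x \<noteq> ?N"
      using N by (auto dest: in_set_takeD)
    ultimately have "takeWhile (\<lambda>x. x \<noteq> ?N) \<tau> = take i \<sigma>"
      by (simp add: that(3) insert_block_def takeWhile_append)
    then show "i = length (takeWhile (\<lambda>x. x \<noteq> ?N) \<tau>)"
      using that length_stirling_perm[OF that(1)] by simp
  qed
  show "inj_on (\<lambda>(\<sigma>, i). insert_block k ?N i \<sigma>) (stirling_perms k n \<times> {0..k * n})"
    by (rule inj_on_inverseI[where g = "\<lambda>\<tau>. (filter (\<lambda>x. x \<noteq> ?N) \<tau>, length (takeWhile (\<lambda>x. x \<noteq> ?N) \<tau>))"])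
      (use recover in auto)
  show "(\<lambda>(\<sigma>, i). insert_block k ?N i \<sigma>) ` (stirling_perms k n \<times> {0..k * n}) = stirling_perms k ?N"
  proof
    show "stirling_perms k ?N \<subseteq> (\<lambda>(\<sigma>, i). insert_block k ?N i \<sigma>) ` (stirling_perms k n \<times> {0..k * n})"
    proof
      fix \<tau> assume "\<tau> \<in> stirling_perms k ?N"
      then obtain \<sigma> i where "\<sigma> \<in> stirling_perms k n" "i \<le> length \<sigma>" "\<tau> = insert_block k ?N i \<sigma>"
        by (rule stirling_perm_is_insert_block)
      then show "\<tau> \<in> (\<lambda>(\<sigma>, i). insert_block k ?N i \<sigma>) ` (stirling_perms k n \<times> {0..k * n})"
        using length_stirling_perm by (auto intro!: image_eqI[of _ _ "(\<sigma>, i)"])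
    qed
  qed (use insert_block_in_stirling_perms in auto)
qed

lemma stirling_perms_0: "stirling_perms k 0 = {[]}"
  by (auto simp: in_stirling_perms_iff)

lemma word_weight_sum_Suc:
  assumes "k \<ge> 1"
  shows "(\<Sum>\<tau>\<in>stirling_perms k (Suc n). word_weight k {#} (padded \<tau>)) =
    grammar_deriv k (\<Sum>\<sigma>\<in>stirling_perms k n. word_weight k {#} (padded \<sigma>))"
proof -
  have "(\<Sum>\<tau>\<in>stirling_perms k (Suc n). word_weight k {#} (padded \<tau>)) =
     (\<Sum>(\<sigma>, i)\<in>stirling_perms k n \<times> {0..k * n}. word_weight k {#} (padded (insert_block k (Suc n) i \<sigma>)))"
    using sum.reindex_bij_betw[OF bij_betw_insert_block[OF assms], of "\<lambda>\<tau>. word_weight k {#} (padded \<tau>)" n]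
    by (simp add: case_prod_unfold)
  also have "\<dots> = (\<Sum>\<sigma>\<in>stirling_perms k n. \<Sum>i\<in>{0..k * n}. word_weight k {#} (padded (insert_block k (Suc n) i \<sigma>)))"
    by (rule sum.cartesian_product[symmetric])
  also have "\<dots> = (\<Sum>\<sigma>\<in>stirling_perms k n. grammar_deriv k (word_weight k {#} (padded \<sigma>)))"
  proof (rule sum.cong)
    fix \<sigma> assume \<sigma>: "\<sigma> \<in> stirling_perms k n"
    have "count (mset (padded \<sigma>)) x \<le> k + 1" for x
      using assms by (simp add: padded_def count_stirling_perm[OF \<sigma>])
    moreover have "x < Suc n" if "x \<in> set \<sigma>" for x
      using that set_stirling_perm[OF \<sigma>] by auto
    ultimately show "(\<Sum>i\<in>{0..k * n}. word_weight k {#} (padded (insert_block k (Suc n) i \<sigma>))) =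
        grammar_deriv k (word_weight k {#} (padded \<sigma>))"
      using grammar_deriv_padded_weight[of k \<sigma> "Suc n"] assms
      by (simp add: length_stirling_perm[OF \<sigma>])
  qed simp
  finally show ?thesis by (simp add: grammar_deriv_sum)
qed

text \<open>
  Starting at \<open>n = 0\<close> is convenient: the padded empty word \<open>[0, 0]\<close> has a single slot, formally a
  1-plateau, and the derivation turns its variable into the product of all variables, which is the
  weight of the only word of order 1.
\<close>

lemma word_weight_sum:
  assumes "k \<ge> 1"
  shows "(\<Sum>\<sigma>\<in>stirling_perms k n. word_weight k {#} (padded \<sigma>)) = (grammar_deriv k ^^ n) (X 1)"
proof (induction n)
  case 0
  show ?case by (simp add: stirling_perms_0 padded_def slot_weight_def)
next
  case (Suc n)
  then show ?case by (simp add: word_weight_sum_Suc[OF assms])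
qed

lemma word_weight_eq_prod:
  "word_weight k h p =
     (\<Prod>i<length p - 1. slot_weight k (h + mset (take i p)) (p ! i) (p ! (i + 1)))"
proof (induction k h p rule: word_weight.induct)
  case (1 k h a b p)
  then show ?case by (simp add: prod.lessThan_Suc_shift del: prod.lessThan_Suc)
qed simp_all

text \<open>
  The same classification of slots as in the weight, now by position, as the statistics are defined.
\<close>

definition slot_index :: "nat \<Rightarrow> nat list \<Rightarrow> nat \<Rightarrow> nat" where
  "slot_index k p i = (if p ! i < p ! (i + 1) then k + 1 else if p ! i > p ! (i + 1) then k
     else Suc (card {l. l < i \<and> p ! l = p ! i}))"

lemma count_take:
  assumes "i \<le> length p"
  shows "count (mset (take i p)) x = card {l. l < i \<and> p ! l = x}"
proof -
  have "{l. l < length (take i p) \<and> x = take i p ! l} = {l. l < i \<and> p ! l = x}"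
    using assms by auto
  then show ?thesis by (simp only: count_mset count_list_eq_length_filter length_filter_conv_card)
qed

text \<open>
  The two equal letters of a plateau and the earlier copies are all among the \<open>k\<close> copies of this
  letter. Thus the index of a plateau is below \<open>k\<close> and does not collide with the variables of
  descents and ascents. The padding letter 0 is not such a letter, so one has to see that it does
  not form a plateau.
\<close>

lemma plateau_slot_index_less:
  assumes \<sigma>: "\<sigma> \<in> stirling_perms k n" and "k \<ge> 1" "n \<ge> 1" and i: "i \<le> length \<sigma>"
    and plateau: "padded \<sigma> ! i = padded \<sigma> ! (i + 1)"
  shows "Suc (card {l. l < i \<and> padded \<sigma> ! l = padded \<sigma> ! i}) < k"
proof -
  let ?p = "padded \<sigma>" and ?x = "padded \<sigma> ! i"
  have len: "length \<sigma> \<ge> 1" using length_stirling_perm[OF \<sigma>] assms by simp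
  have pos: "\<sigma> ! l \<ge> 1" if "l < length \<sigma>" for l
    using set_stirling_perm[OF \<sigma>] nth_mem[OF that] by auto
  have x: "?x \<noteq> 0"
  proof (cases i)
    case 0
    then show ?thesis using plateau len pos[of 0] by (cases \<sigma>) (auto simp: padded_def)
  next
    case (Suc l)
    then show ?thesis using i pos[of l] by (auto simp: padded_def nth_append)
  qed
  have "{l. l < i \<and> ?p ! l = ?x} \<union> {i, i + 1} \<subseteq> {l. l < length ?p \<and> ?p ! l = ?x}"
    using i plateau by (auto simp: padded_def)
  then have "card ({l. l < i \<and> ?p ! l = ?x} \<union> {i, i + 1}) \<le> card {l. l < length ?p \<and> ?p ! l = ?x}"
    by (rule card_mono[rotated]) simp
  then have "card ({l. l < i \<and> ?p ! l = ?x} \<union> {i, i + 1}) \<le> count (mset ?p) ?x"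
    using count_take[of "length ?p" ?p ?x] by simp
  moreover have "card ({l. l < i \<and> ?p ! l = ?x} \<union> {i, i + 1}) = card {l. l < i \<and> ?p ! l = ?x} + 2"
    by (subst card_Un_disjoint) auto
  moreover have "count (mset ?p) ?x \<le> k"
    using x count_stirling_perm[OF \<sigma>, of ?x] by (auto simp: padded_def)
  ultimately show ?thesis by simp
qed

lemma eulerian_term_eq_word_weight:
  assumes \<sigma>: "\<sigma> \<in> stirling_perms k n" and k: "k \<ge> 1" and n: "n \<ge> 1"
  shows "(\<Prod>j=1..k-1. X j ^ plat j \<sigma>) * X k ^ des \<sigma> * X (k + 1) ^ asc \<sigma> =
    word_weight k {#} (padded \<sigma>)"
proof -
  let ?p = "padded \<sigma>" and ?I = "{0..length \<sigma>}"
  let ?c = "slot_index k (padded \<sigma>)"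
  note less = plateau_slot_index_less[OF \<sigma> k n]
  have slot_cases: "(?c i = k + 1 \<longleftrightarrow> ?p ! i < ?p ! (i + 1)) \<and> (?c i = k \<longleftrightarrow> ?p ! i > ?p ! (i + 1))"
    if "i \<in> ?I" for i
  proof (cases "?p ! i = ?p ! (i + 1)")
    case True
    then show ?thesis using that less[of i] by (simp add: slot_index_def)
  next
    case False
    then show ?thesis by (simp add: slot_index_def)
  qed
  have range: "?c ` ?I \<subseteq> {1..k+1}"
    using less k by (fastforce simp: slot_index_def)
  have "word_weight k {#} ?p = (\<Prod>i\<in>?I. X (?c i))"
    unfolding word_weight_eq_prod
    by (intro prod.cong) (auto simp: padded_def slot_weight_def slot_index_def count_take)
  also have "\<dots> = (\<Prod>j\<in>{1..k+1}. \<Prod>i\<in>{i\<in>?I. ?c i = j}. X (?c i))"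
    by (rule prod.group[symmetric]) (use range in auto)
  also have "\<dots> = (\<Prod>j\<in>{1..k+1}. X j ^ card {i\<in>?I. ?c i = j})"
    by (intro prod.cong) auto
  also have "{1..k+1} = insert (k + 1) (insert k {1..k-1})" using k by auto
  also have "(\<Prod>j\<in>insert (k + 1) (insert k {1..k-1}). X j ^ card {i\<in>?I. ?c i = j}) =
      X (k + 1) ^ card {i\<in>?I. ?c i = k + 1} * (X k ^ card {i\<in>?I. ?c i = k} *
      (\<Prod>j=1..k-1. X j ^ card {i\<in>?I. ?c i = j}))"
    using k by (subst prod.insert, simp, force, subst prod.insert) auto
  also have "{i\<in>?I. ?c i = k + 1} = {i\<in>?I. ?p ! i < ?p ! (i + 1)}"
    using slot_cases by blast
  also have "{i\<in>?I. ?c i = k} = {i\<in>?I. ?p ! i > ?p ! (i + 1)}"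
    using slot_cases by blast
  also have "(\<Prod>j=1..k-1. X j ^ card {i\<in>?I. ?c i = j}) = (\<Prod>j=1..k-1. X j ^ plat j \<sigma>)"
  proof (intro prod.cong refl)
    fix j assume "j \<in> {1..k-1}"
    then have "{i\<in>?I. ?c i = j} = {i\<in>?I. ?p ! i = ?p ! (i + 1) \<and>
        card {l. l < i \<and> ?p ! l = ?p ! i} + 1 = j}"
      by (auto simp: slot_index_def)
    then show "X j ^ card {i\<in>?I. ?c i = j} = X j ^ plat j \<sigma>" by (simp add: plat_def)
  qed
  finally show ?thesis by (simp add: asc_def des_def mult_ac)
qed

lemma eulerian_poly_eq_grammar_deriv:
  assumes "k \<ge> 1" "n \<ge> 1"
  shows "eulerian_poly k n = (grammar_deriv k ^^ n) (X 1)"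
  unfolding eulerian_poly_def word_weight_sum[OF assms(1), symmetric]
  by (intro sum.cong refl) (use assms eulerian_term_eq_word_weight[of _ k n] in auto)

section \<open>Increasing plane trees and insertion of a maximal leaf\<close>

text \<open>
  All ways of adding \<open>N\<close> as a new leaf: among the children of the root, or inside one of the
  subtrees. The second function inserts within the trees of a forest and leaves its roots unchanged.
  Lists rather than sets make the sum over all insertions follow the recursion.
\<close>

fun grow :: "nat \<Rightarrow> ptree \<Rightarrow> ptree list" and grow_below :: "nat \<Rightarrow> ptree list \<Rightarrow> ptree list list" where
  "grow N (Node a ts) =
     map (Node a) (map (\<lambda>i. take i ts @ Node N [] # drop i ts) [0..<Suc (length ts)] @ grow_below N ts)"
| "grow_below N [] = []"
| "grow_below N (t # ts) = map (\<lambda>t'. t' # ts) (grow N t) @ map ((#) t) (grow_below N ts)"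

fun prune :: "nat \<Rightarrow> ptree \<Rightarrow> ptree" where
  "prune N (Node a ts) = Node a (map (prune N) (filter (\<lambda>t. root_label t \<noteq> N) ts))"

definition labels :: "ptree \<Rightarrow> nat list" where
  "labels t = map root_label (vertices t)"

lemma labels_Node [simp]: "labels (Node a ts) = a # concat (map labels ts)"
  by (simp add: labels_def[abs_def] map_concat comp_def)

lemma root_label_in_labels [simp]: "root_label t \<in> set (labels t)"
  by (cases t) simp

definition increasing :: "ptree \<Rightarrow> bool" where
  "increasing t \<longleftrightarrow> (\<forall>v\<in>set (vertices t). \<forall>c\<in>set (children v). root_label v < root_label c)"

lemma increasing_Node [simp]:
  "increasing (Node a ts) \<longleftrightarrow> (\<forall>c\<in>set ts. a < root_label c \<and> increasing c)"
  by (auto simp: increasing_def)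

lemma increasing_plane_trees_iff:
  "t \<in> increasing_plane_trees n \<longleftrightarrow>
     distinct (labels t) \<and> set (labels t) = {1..n} \<and> root_label t = 1 \<and> increasing t"
  by (simp add: increasing_plane_trees_def labels_def increasing_def)

definition tree_weight :: "(nat \<Rightarrow> 'a :: comm_monoid_mult) \<Rightarrow> ptree \<Rightarrow> 'a" where
  "tree_weight f t = prod_list (map (\<lambda>v. f (vdegree v)) (vertices t))"

lemma tree_weight_Node [simp]:
  "tree_weight f (Node a ts) = f (length ts) * prod_list (map (tree_weight f) ts)"
proof -
  have "prod_list (map g (concat xss)) = prod_list (map (\<lambda>xs. prod_list (map g xs)) xss)"
    for g :: "ptree \<Rightarrow> 'a" and xss
    by (induction xss) simp_all
  then show ?thesis by (simp add: tree_weight_def[abs_def] vdegree_def comp_def)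
qed

text \<open>
  The product rule again: differentiating the factor of a vertex counts the places for a new leaf
  below that vertex.
\<close>

lemma grammar_deriv_tree_weight:
  fixes k :: nat
  defines "W \<equiv> tree_weight (degree_weight k)"
  shows "grammar_deriv k (W t) = (\<Sum>t'\<leftarrow>grow N t. W t')"
    and "grammar_deriv k (prod_list (map W ts)) = (\<Sum>ts'\<leftarrow>grow_below N ts. prod_list (map W ts'))"
proof (induction N t and N ts rule: grow_grow_below.induct)
  case (1 N a ts)
  have len: "length ts' = length ts" if "ts' \<in> set (grow_below N ts)" for ts'
    using that by (induction ts arbitrary: ts') auto
  have "(\<Sum>ts'\<leftarrow>grow_below N ts. W (Node a ts')) =
      (\<Sum>ts'\<leftarrow>grow_below N ts. degree_weight k (length ts) * prod_list (map W ts'))"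
    by (intro arg_cong[of _ _ sum_list] map_cong) (simp_all add: W_def len)
  then have below: "(\<Sum>ts'\<leftarrow>grow_below N ts. W (Node a ts')) =
      degree_weight k (length ts) * grammar_deriv k (prod_list (map W ts))"
    by (simp add: 1 sum_list_const_mult)
  have "W (Node a (take i ts @ Node N [] # drop i ts)) =
      degree_weight k (Suc (length ts)) * degree_weight k 0 * prod_list (map W ts)"
    if "i < Suc (length ts)" for i
  proof -
    have "prod_list (map W (take i ts)) * prod_list (map W (drop i ts)) = prod_list (map W ts)"
      by (metis append_take_drop_id map_append prod_list.append)
    then show ?thesis using that by (simp add: W_def mult_ac)
  qed
  then have "(\<Sum>i\<leftarrow>[0..<Suc (length ts)]. W (Node a (take i ts @ Node N [] # drop i ts))) =
      (\<Sum>i\<leftarrow>[0..<Suc (length ts)]. degree_weight k (Suc (length ts)) * degree_weight k 0 * prod_list (map W ts))"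
    by (intro arg_cong[of _ _ sum_list] map_cong) auto
  also have "\<dots> = grammar_deriv k (degree_weight k (length ts)) * prod_list (map W ts)"
    by (simp add: grammar_deriv_degree_weight sum_list_triv algebra_simps del: upt_Suc)
  finally show ?case
    using below by (simp add: comp_def grammar_deriv_mult W_def del: upt_Suc)
next
  case (3 N t ts)
  then show ?case
    by (simp add: grammar_deriv_mult comp_def sum_list_const_mult sum_list_mult_const)
qed simp_all

lemma root_label_grow: "t' \<in> set (grow N t) \<Longrightarrow> root_label t' = root_label t"
  by (cases t) auto

lemma map_root_label_grow_below:
  "ts' \<in> set (grow_below N ts) \<Longrightarrow> map root_label ts' = map root_label ts"
  by (induction ts arbitrary: ts') (auto simp: root_label_grow)

lemma mset_labels_grow:
  "t' \<in> set (grow N t) \<Longrightarrow> mset (labels t') = add_mset N (mset (labels t))"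
  "ts' \<in> set (grow_below N ts) \<Longrightarrow>
     mset (concat (map labels ts')) = add_mset N (mset (concat (map labels ts)))"
proof (induction N t and N ts arbitrary: t' and ts' rule: grow_grow_below.induct)
  case (1 N a ts)
  have "mset (concat (map labels (take i ts))) + mset (concat (map labels (drop i ts))) =
      mset (concat (map labels ts))" for i
    by (metis append_take_drop_id concat_append map_append mset_append)
  with 1 show ?case by (auto simp del: upt_Suc)
qed auto

lemma increasing_grow:
  "t' \<in> set (grow N t) \<Longrightarrow> \<forall>l\<in>set (labels t). l < N \<Longrightarrow> increasing t' \<longleftrightarrow> increasing t"
  "ts' \<in> set (grow_below N ts) \<Longrightarrow> \<forall>t\<in>set ts. \<forall>l\<in>set (labels t). l < N \<Longrightarrow>
     (\<forall>t\<in>set ts'. increasing t) \<longleftrightarrow> (\<forall>t\<in>set ts. increasing t)"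
proof (induction N t and N ts arbitrary: t' and ts' rule: grow_grow_below.induct)
  case (1 N a ts)
  from "1.prems"(1) consider
      (top) i where "t' = Node a (take i ts @ Node N [] # drop i ts)"
    | (below) ts' where "t' = Node a ts'" "ts' \<in> set (grow_below N ts)"
    by (auto simp del: upt_Suc)
  then show ?case
  proof cases
    case top
    have "set (take i ts) \<union> set (drop i ts) = set ts"
      by (metis append_take_drop_id set_append)
    then show ?thesis using "1.prems"(2) top by auto
  next
    case below
    have "root_label ` set ts' = root_label ` set ts"
      using map_root_label_grow_below[OF below(2)] by (metis set_map)
    then have "(\<forall>c\<in>set ts'. a < root_label c) \<longleftrightarrow> (\<forall>c\<in>set ts. a < root_label c)"
      by (metis (no_types, lifting) image_iff)
    moreover have "(\<forall>t\<in>set ts'. increasing t) \<longleftrightarrow> (\<forall>t\<in>set ts. increasing t)"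
      using "1.IH"[OF below(2)] "1.prems"(2) by auto
    ultimately show ?thesis using below(1) by auto
  qed
next
  case (3 N t ts)
  from "3.prems"(1) consider
      (head) t' where "t' \<in> set (grow N t)" "ts' = t' # ts"
    | (tail) us where "us \<in> set (grow_below N ts)" "ts' = t # us"
    by auto
  then show ?case
  proof cases
    case head
    then show ?thesis using "3.IH"(1)[OF head(1)] "3.prems"(2) by simp
  next
    case tail
    then show ?thesis using "3.IH"(2)[OF tail(1)] "3.prems"(2) by simp
  qed
qed auto

lemma prune_fresh: "N \<notin> set (labels t) \<Longrightarrow> prune N t = t"
proof (induction t)
  case (Node a ts)
  then have "filter (\<lambda>t. root_label t \<noteq> N) ts = ts"
    unfolding filter_id_conv using root_label_in_labels by fastforce
  moreover have "map (prune N) ts = ts"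
    using Node by (intro map_idI) auto
  ultimately show ?case by simp
qed

lemma map_prune_fresh:
  "\<forall>t\<in>set ts. N \<notin> set (labels t) \<Longrightarrow> map (prune N) (filter (\<lambda>t. root_label t \<noteq> N) ts) = ts"
  \<comment> \<open>Joining the trees under a root whose label differs from \<open>N\<close> reduces a forest to one tree.\<close>
  using prune_fresh[of N "Node (Suc N) ts"] by simp

text \<open>
  Deleting the new leaf undoes every insertion, so different trees have no common extension.
\<close>

lemma prune_grow:
  "t' \<in> set (grow N t) \<Longrightarrow> N \<notin> set (labels t) \<Longrightarrow> prune N t' = t"
  "ts' \<in> set (grow_below N ts) \<Longrightarrow> \<forall>t\<in>set ts. N \<notin> set (labels t) \<Longrightarrow>
     map (prune N) (filter (\<lambda>t. root_label t \<noteq> N) ts') = ts"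
proof (induction N t and N ts arbitrary: t' and ts' rule: grow_grow_below.induct)
  case (1 N a ts)
  from "1.prems"(1) consider
      (top) i where "t' = Node a (take i ts @ Node N [] # drop i ts)"
    | (below) ts' where "t' = Node a ts'" "ts' \<in> set (grow_below N ts)"
    by (auto simp del: upt_Suc)
  then show ?case
  proof cases
    case top
    have "map (prune N) (filter (\<lambda>t. root_label t \<noteq> N) (take i ts @ drop i ts)) = ts"
      using "1.prems"(2) map_prune_fresh[of ts N] by simp
    then show ?thesis unfolding filter_append map_append using top by simp
  next
    case below
    then show ?thesis using 1 by simp
  qed
next
  case (3 N t ts)
  have "root_label t \<noteq> N" using 3(4) by auto
  moreover have "map (prune N) (filter (\<lambda>t. root_label t \<noteq> N) ts) = ts"
    using 3(4) by (intro map_prune_fresh) simp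
  ultimately show ?case
    using 3 by (auto simp: root_label_grow prune_fresh)
qed auto

lemma grow_below_append:
  "t' \<in> set (grow N t) \<Longrightarrow> us @ t' # vs \<in> set (grow_below N (us @ t # vs))"
  by (induction us) auto

text \<open>
  In an increasing tree the largest label sits at a leaf, so deleting it leaves an increasing tree
  from which the original arises by an insertion.
\<close>

lemma grow_prune:
  assumes "increasing t" "\<forall>l\<in>set (labels t). l \<le> N" "count (mset (labels t)) N = 1" "root_label t \<noteq> N"
  shows "t \<in> set (grow N (prune N t))"
  using assms
proof (induction t)
  case (Node a ts)
  then have "count (mset (concat (map labels ts))) N \<noteq> 0" by simp
  then have "N \<in> set (concat (map labels ts))" unfolding count_mset_0_iff by simp
  then obtain c where "c \<in> set ts" "N \<in> set (labels c)" by auto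
  then obtain us vs where ts: "ts = us @ c # vs" by (meson split_list)
  have "count (mset (labels c)) N \<noteq> 0"
    using \<open>N \<in> set (labels c)\<close> unfolding count_mset_0_iff by simp
  moreover have "count (mset (concat (map labels us))) N + count (mset (labels c)) N +
      count (mset (concat (map labels vs))) N = 1"
    using Node.prems(3,4) by (simp add: ts)
  ultimately have c1: "count (mset (labels c)) N = 1"
    and "count (mset (concat (map labels us))) N = 0" "count (mset (concat (map labels vs))) N = 0"
    by linarith+
  then have "N \<notin> set (concat (map labels us))" "N \<notin> set (concat (map labels vs))"
    unfolding count_mset_0_iff by blast+
  then have us: "map (prune N) (filter (\<lambda>t. root_label t \<noteq> N) us) = us"
    and vs: "map (prune N) (filter (\<lambda>t. root_label t \<noteq> N) vs) = vs"
    by (intro map_prune_fresh; simp)+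
  show ?case
  proof (cases "root_label c = N")
    case True
    have "children c = []"
    proof (rule ccontr)
      assume "children c \<noteq> []"
      then obtain d where d: "d \<in> set (children c)" by (cases "children c") auto
      have "root_label c < root_label d"
        using Node.prems(1) d by (cases c) (auto simp: ts)
      moreover have "root_label d \<in> set (labels c)"
        using d by (cases c) (simp, blast intro: root_label_in_labels)
      then have "root_label d \<le> N" using Node.prems(2) by (auto simp: ts)
      ultimately show False using True by simp
    qed
    then have c: "c = Node N []" using True by (cases c) auto
    have "ts \<in> set (map (\<lambda>i. take i (us @ vs) @ Node N [] # drop i (us @ vs)) [0..<Suc (length (us @ vs))])"
      unfolding set_map by (rule image_eqI[of _ _ "length us"]) (simp_all add: ts c del: upt_Suc)
    moreover have "prune N (Node a ts) = Node a (us @ vs)"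
      by (simp add: ts c us vs)
    ultimately show ?thesis by (simp only: grow.simps set_map set_append) blast
  next
    case False
    have "c \<in> set (grow N (prune N c))"
      using Node.prems False c1 by (intro Node.IH) (auto simp: ts)
    then have "ts \<in> set (grow_below N (us @ prune N c # vs))"
      unfolding ts by (rule grow_below_append)
    moreover have "prune N (Node a ts) = Node a (us @ prune N c # vs)"
      using False by (simp add: ts us vs)
    ultimately show ?thesis by (simp del: upt_Suc)
  qed
qed

text \<open>
  Different places give different trees: a new child of the root is located by its label among the
  roots of the subtrees, and such a label is absent when the insertion takes place further below.
\<close>

lemma distinct_grow:
  "N \<notin> set (labels t) \<Longrightarrow> distinct (grow N t)"
  "\<forall>t\<in>set ts. N \<notin> set (labels t) \<Longrightarrow> distinct (grow_below N ts)"
proof (induction N t and N ts rule: grow_grow_below.induct)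
  case (1 N a ts)
  have roots: "\<forall>t\<in>set ts. root_label t \<noteq> N" 
    using "1.prems" root_label_in_labels by fastforce
  have "length (takeWhile (\<lambda>t. root_label t \<noteq> N) (take i ts @ Node N [] # drop i ts)) = i"
    if "i < Suc (length ts)" for i
  proof -
    have "\<forall>t\<in>set (take i ts). root_label t \<noteq> N" using roots by (auto dest: in_set_takeD)
    then show ?thesis using that by (simp add: takeWhile_append)
  qed
  then have "inj_on (\<lambda>i. take i ts @ Node N [] # drop i ts) {0..<Suc (length ts)}"
    by (intro inj_on_inverseI[where g = "\<lambda>ts. length (takeWhile (\<lambda>t. root_label t \<noteq> N) ts)"]) auto
  then have "distinct (map (\<lambda>i. take i ts @ Node N [] # drop i ts) [0..<Suc (length ts)])"
    by (simp add: distinct_map del: upt_Suc)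
  moreover have "ts' \<notin> set (grow_below N ts)" if "Node N [] \<in> set ts'" for ts'
  proof
    assume "ts' \<in> set (grow_below N ts)"
    then have "root_label ` set ts' = root_label ` set ts"
      by (metis map_root_label_grow_below set_map)
    then show False using that roots by (metis image_iff ptree.sel(1))
  qed
  ultimately have "distinct (map (\<lambda>i. take i ts @ Node N [] # drop i ts) [0..<Suc (length ts)] @ grow_below N ts)"
    using 1 by (auto simp del: upt_Suc)
  then show ?case
    by (simp only: grow.simps distinct_map[of "Node a"]) (simp add: inj_on_def)
next
  case (3 N t ts)
  have "t \<notin> set (grow N t)"
    using mset_labels_grow(1)[of t N t] by auto
  then have "set (map (\<lambda>t'. t' # ts) (grow N t)) \<inter> set (map ((#) t) (grow_below N ts)) = {}"
    by auto
  moreover have "distinct (map (\<lambda>t'. t' # ts) (grow N t))" "distinct (map ((#) t) (grow_below N ts))"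
    using 3 by (simp_all add: distinct_map inj_on_def)
  ultimately show ?case by (simp only: grow_below.simps distinct_append)
qed simp_all

lemma grow_in_increasing_plane_trees:
  assumes t: "t \<in> increasing_plane_trees n" and t': "t' \<in> set (grow (Suc n) t)"
  shows "t' \<in> increasing_plane_trees (Suc n)"
proof -
  note * = t[unfolded increasing_plane_trees_iff]
  have m: "mset (labels t') = mset (Suc n # labels t)"
    using mset_labels_grow(1)[OF t'] by simp
  have "distinct (labels t')" "set (labels t') = {1..Suc n}"
    using * mset_eq_imp_distinct_iff[OF m] mset_eq_setD[OF m] by auto
  moreover have "increasing t'"
    using increasing_grow(1)[OF t'] * by auto
  ultimately show ?thesis
    using * root_label_grow[OF t'] by (simp add: increasing_plane_trees_iff)
qed

lemma prune_in_increasing_plane_trees: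
  assumes t': "t' \<in> increasing_plane_trees (Suc n)" and "n \<ge> 1"
  shows "prune (Suc n) t' \<in> increasing_plane_trees n" "t' \<in> set (grow (Suc n) (prune (Suc n) t'))"
proof -
  let ?t = "prune (Suc n) t'"
  note * = t'[unfolded increasing_plane_trees_iff]
  show grown: "t' \<in> set (grow (Suc n) ?t)"
  proof (rule grow_prune)
    have "Suc n \<in> set (labels t')" using * by simp
    then show "count (mset (labels t')) (Suc n) = 1"
      using * by (simp only: distinct_count_atmost_1 if_True)
  qed (use * \<open>n \<ge> 1\<close> in simp_all)
  have m: "mset (labels t') = mset (Suc n # labels ?t)"
    using mset_labels_grow(1)[OF grown] by simp
  have d: "distinct (Suc n # labels ?t)" and s: "insert (Suc n) (set (labels ?t)) = {1..Suc n}"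
    using * mset_eq_imp_distinct_iff[OF m] mset_eq_setD[OF m] by auto
  then have "set (labels ?t) = {1..Suc n} - {Suc n}" by auto
  also have "{1..Suc n} - {Suc n} = {1..n}" by auto
  finally have labels_t: "set (labels ?t) = {1..n}" .
  moreover have "increasing ?t"
    using increasing_grow(1)[OF grown] * unfolding labels_t by simp
  ultimately show "?t \<in> increasing_plane_trees n"
    using * d root_label_grow[OF grown] by (simp add: increasing_plane_trees_iff)
qed

lemma Suc_notin_labels: "t \<in> increasing_plane_trees n \<Longrightarrow> Suc n \<notin> set (labels t)"
  by (simp add: increasing_plane_trees_iff)

lemma increasing_plane_trees_Suc:
  assumes "n \<ge> 1"
  shows "increasing_plane_trees (Suc n) = (\<Union>t\<in>increasing_plane_trees n. set (grow (Suc n) t))"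
  using prune_in_increasing_plane_trees[OF _ assms] grow_in_increasing_plane_trees by blast

lemma increasing_plane_trees_1: "increasing_plane_trees 1 = {Node 1 []}"
proof -
  have "t = Node 1 []" if t: "t \<in> increasing_plane_trees 1" for t
  proof (cases t)
    case (Node a ts)
    have "c \<notin> set ts" for c
    proof
      assume c: "c \<in> set ts"
      then have "root_label c \<in> set (labels t)"
        unfolding Node labels_Node by (simp, blast intro: root_label_in_labels)
      then have "root_label c = 1" using t by (simp add: increasing_plane_trees_iff)
      moreover have "1 < root_label c" using t c by (auto simp: increasing_plane_trees_iff Node)
      ultimately show False by simp
    qed
    then have "ts = []" by (cases ts) auto
    then show ?thesis using t by (simp add: increasing_plane_trees_iff Node)
  qed
  moreover have "Node 1 [] \<in> increasing_plane_trees 1" by (auto simp: increasing_plane_trees_iff)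
  ultimately show ?thesis by blast
qed

lemma finite_increasing_plane_trees: "n \<ge> 1 \<Longrightarrow> finite (increasing_plane_trees n)"
proof (induction n rule: nat_induct_at_least)
  case base then show ?case by (simp only: increasing_plane_trees_1 finite.intros)
next
  case (Suc n) then show ?case by (simp add: increasing_plane_trees_Suc)
qed

text \<open>
  The trees on \<open>[n + 1]\<close> are partitioned by the tree on \<open>[n]\<close> left after deleting the largest label.
  On \<open>[1]\<close> there is one vertex of degree 0, of weight \<open>e\<^sub>k\<^sub>+\<^sub>1\<close>, which is also the derivative of \<open>x\<^sub>1\<close>.
\<close>

lemma tree_weight_sum:
  assumes "n \<ge> 1"
  shows "(\<Sum>t\<in>increasing_plane_trees n. tree_weight (degree_weight k) t) = (grammar_deriv k ^^ n) (X 1)"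
  using assms
proof (induction n rule: nat_induct_at_least)
  case base
  have "(grammar_deriv k ^^ 1) (X 1) = (\<Prod>j=1..k+1. X j)"
    using grammar_deriv_X[of 1 k] by simp
  then show ?case
    unfolding increasing_plane_trees_1 by (simp add: degree_weight_0)
next
  case (Suc n)
  let ?W = "tree_weight (degree_weight k)"
  have "(\<Sum>t'\<in>increasing_plane_trees (Suc n). ?W t') =
      (\<Sum>t\<in>increasing_plane_trees n. \<Sum>t'\<in>set (grow (Suc n) t). ?W t')"
    unfolding increasing_plane_trees_Suc[OF Suc.hyps]
  proof (rule sum.UNION_disjoint)
    show "\<forall>t\<in>increasing_plane_trees n. \<forall>u\<in>increasing_plane_trees n. t \<noteq> u \<longrightarrow>
        set (grow (Suc n) t) \<inter> set (grow (Suc n) u) = {}"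
      using prune_grow(1) Suc_notin_labels by blast
  qed (use finite_increasing_plane_trees[OF Suc.hyps] in auto)
  also have "\<dots> = (\<Sum>t\<in>increasing_plane_trees n. grammar_deriv k (?W t))"
    by (intro sum.cong refl)
      (simp add: grammar_deriv_tree_weight(1)[of k _ "Suc n"] sum_list_distinct_conv_sum_set
        distinct_grow(1) Suc_notin_labels)
  also have "\<dots> = grammar_deriv k (\<Sum>t\<in>increasing_plane_trees n. ?W t)"
    by (simp only: grammar_deriv_sum)
  finally show ?case using Suc.IH by simp
qed

section \<open>Degree sequences of increasing plane trees\<close>

lemma length_vertices: "t \<in> increasing_plane_trees n \<Longrightarrow> length (vertices t) = n"
  unfolding increasing_plane_trees_iff labels_def
  by (metis card_atLeastAtMost diff_Suc_1 distinct_card length_map)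

lemma sum_degrees: "Suc (\<Sum>v\<leftarrow>vertices t. vdegree v) = length (vertices t)"
proof (induction t)
  case (Node a ts)
  have "(\<Sum>v\<leftarrow>concat (map vertices us). vdegree v) + length us = length (concat (map vertices us))"
    if "set us \<subseteq> set ts" for us
    using that Node by (induction us) fastforce+
  from this[of ts] show ?case by (simp add: vdegree_def)
qed

text \<open>
  Entries \<open>m\<close> are counted exactly, and every other nonzero entry is bounded below by 1. For vertex
  degrees, whose sum is one less than their number, this bounds the number of leaves from below.
\<close>

lemma sum_list_ge_count:
  fixes ds :: "nat list"
  assumes "m \<ge> 1"
  shows "m * length (filter (\<lambda>d. d = m) ds) + length ds \<le>
    sum_list ds + length (filter (\<lambda>d. d = m) ds) + length (filter (\<lambda>d. d = 0) ds)"
  using assms by (induction ds) auto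

lemma num_of_degree_eq:
  "num_of_degree d t = length (filter (\<lambda>e. e = d) (map vdegree (vertices t)))"
  by (simp add: num_of_degree_def filter_map comp_def)

lemma vdegree_less:
  assumes "t \<in> increasing_plane_trees n" "v \<in> set (vertices t)"
  shows "vdegree v < n"
proof -
  have "vdegree v \<le> (\<Sum>v\<leftarrow>vertices t. vdegree v)"
    using assms(2) by (intro member_le_sum_list) auto
  then show ?thesis using sum_degrees[of t] length_vertices[OF assms(1)] by simp
qed

lemma prod_list_group:
  fixes f :: "nat \<Rightarrow> 'a :: comm_monoid_mult"
  assumes "\<forall>d\<in>set ds. d < n"
  shows "prod_list (map f ds) = (\<Prod>d<n. f d ^ length (filter (\<lambda>e. e = d) ds))"
  using assms
proof (induction ds)
  case (Cons d ds)
  have "(\<Prod>e<n. f e ^ length (filter (\<lambda>x. x = e) (d # ds))) =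
      (\<Prod>e<n. (if e = d then f d else 1) * f e ^ length (filter (\<lambda>x. x = e) ds))"
    by (intro prod.cong) auto
  also have "\<dots> = f d * (\<Prod>e<n. f e ^ length (filter (\<lambda>x. x = e) ds))"
    using Cons.prems by (simp add: prod.distrib)
  finally show ?case using Cons by simp
qed simp

lemma tree_weight_eq_prod:
  assumes "t \<in> increasing_plane_trees n"
  shows "tree_weight f t = (\<Prod>d<n. f d ^ num_of_degree d t)"
  using prod_list_group[of "map vdegree (vertices t)" n f] vdegree_less[OF assms]
  by (simp add: tree_weight_def num_of_degree_eq comp_def)

text \<open>
  Position \<open>j\<close> counts the vertices of degree \<open>j - 1\<close>. Restriction to \<open>{1..n}\<close> makes the sequence
  an extensional function, as index sequences are.
\<close>

definition degree_seq :: "nat \<Rightarrow> ptree \<Rightarrow> nat \<Rightarrow> nat" where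
  "degree_seq n t = restrict (\<lambda>j. num_of_degree (j - 1) t) {1..n}"

text \<open>
  Everything follows from the degree sum \<open>n - 1\<close>. Two vertices of degree \<open>n - 1\<close> would exceed it;
  one such vertex exhausts it, so that all other vertices are leaves; and with no leaf at all the sum
  would be at least \<open>n\<close>. The root is not a leaf since \<open>n \<ge> 2\<close>.
\<close>

lemma degree_seq_in_index_seqs:
  assumes "n \<ge> 2" and t: "t \<in> increasing_plane_trees n"
  shows "degree_seq n t \<in> index_seqs n"
proof -
  define ds where "ds = map vdegree (vertices t)"
  define c where "c d = length (filter (\<lambda>e. e = d) ds)" for d
  have c: "num_of_degree d t = c d" for d by (simp add: num_of_degree_eq c_def ds_def)
  have len: "length ds = n" using length_vertices[OF t] by (simp add: ds_def)
  have sum: "Suc (sum_list ds) = n" using sum_degrees[of t] length_vertices[OF t] by (simp add: ds_def)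
  have small: "\<forall>d\<in>set ds. d < n" using vdegree_less[OF t] by (auto simp: ds_def)
  have "length ds = (\<Sum>d<n. c d)"
    unfolding c_def using small
  proof (induction ds)
    case (Cons d ds)
    have "(\<Sum>e<n. length (filter (\<lambda>x. x = e) (d # ds))) =
      (\<Sum>e<n. (if e = d then 1 else 0) + length (filter (\<lambda>x. x = e) ds))"
      by (intro sum.cong) auto
    then show ?case using Cons by (simp add: sum.distrib)
  qed simp
  also have "\<dots> = (\<Sum>j=1..n. c (j - 1))"
    by (rule sum.reindex_bij_witness[of _ "\<lambda>j. j - 1" Suc]) auto
  finally have total: "(\<Sum>j=1..n. c (j - 1)) = n" using len by simp
  have "\<exists>v ts. vertices t = v # ts \<and> vdegree v \<noteq> 0"
  proof (cases t)
    case (Node a us)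
    then have "us \<noteq> []" using length_vertices[OF t] \<open>n \<ge> 2\<close> by auto
    then show ?thesis using Node by (simp add: vdegree_def)
  qed
  then obtain d ds' where ds: "ds = d # ds'" "d \<noteq> 0" by (auto simp: ds_def)
  have "c 0 \<le> length ds'" using ds by (simp add: c_def)
  then have c0: "c 0 \<le> n - 1" using ds len by simp
  \<comment> \<open>The case \<open>m = 1\<close> of the estimate says that the number of nonzero degrees is at most their sum.\<close>
  have bound1: "1 * c 1 + n \<le> sum_list ds + c 1 + c 0"
    using sum_list_ge_count[of 1 ds] len by (simp add: c_def)
  then have c1: "1 \<le> c 0" using sum by simp
  have bound: "(n - 1) * c (n - 1) + n \<le> sum_list ds + c (n - 1) + c 0"
    using sum_list_ge_count[of "n - 1" ds] len \<open>n \<ge> 2\<close> by (simp add: c_def)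
  have cn: "c (n - 1) \<le> 1"
  proof (rule ccontr)
    assume "\<not> c (n - 1) \<le> 1"
    then have "2 \<le> length (filter (\<lambda>e. e = n - 1) ds)" by (simp add: c_def)
    moreover have "(n - 1) * length (filter (\<lambda>e. e = n - 1) ds) \<le> sum_list ds"
      by (induction ds) (auto simp: algebra_simps)
    ultimately have "(n - 1) * 2 \<le> sum_list ds"
      by (meson le_trans mult_le_mono2)
    then show False using sum \<open>n \<ge> 2\<close> by simp
  qed
  have cn1: "c 0 = n - 1" if "c (n - 1) = 1"
    using bound that sum c0 by simp
  show ?thesis
    unfolding index_seqs_def degree_seq_def c using total c0 c1 cn cn1 \<open>n \<ge> 2\<close>
    by (auto simp: le_Suc_eq)
qed

lemma finite_index_seqs: "finite (index_seqs n)"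
proof (rule finite_subset)
  show "index_seqs n \<subseteq> {1..n} \<rightarrow>\<^sub>E {0..n}"
  proof
    fix i assume i: "i \<in> index_seqs n"
    have "i j \<le> n" if "j \<in> {1..n}" for j
      using i member_le_sum[of j "{1..n}" i] that by (simp add: index_seqs_def del: One_nat_def)
    then show "i \<in> {1..n} \<rightarrow>\<^sub>E {0..n}"
      using i by (auto simp: index_seqs_def PiE_def)
  qed
qed (simp add: finite_PiE)

text \<open>
  Here the hypothesis \<open>k \<ge> n - 2\<close> enters: a vertex of a tree on \<open>[n]\<close> has at most
  \<open>n - 1 \<le> k + 1\<close> children.
\<close>

lemma bounded_increasing_plane_trees_eq:
  assumes "n \<le> k + 2"
  shows "bounded_increasing_plane_trees (k + 1) n = increasing_plane_trees n"
  using vdegree_less assms unfolding bounded_increasing_plane_trees_def by fastforce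

lemma gamma_coeff_eq:
  assumes "n \<le> k + 2" "i \<in> index_seqs n"
  shows "gamma_coeff k n i = card {t \<in> increasing_plane_trees n. degree_seq n t = i}"
proof -
  have "i \<in> extensional {1..n}" using assms(2) by (simp add: index_seqs_def PiE_def)
  then have "(\<forall>j\<in>{1..n}. num_of_degree (j - 1) t = i j) \<longleftrightarrow> degree_seq n t = i" for t
    unfolding degree_seq_def by (auto simp: fun_eq_iff extensional_def restrict_def)
  then show ?thesis
    unfolding gamma_coeff_def bounded_increasing_plane_trees_eq[OF assms(1)] by simp
qed

lemma tree_weight_eq_degree_seq_prod:
  assumes "n \<le> k + 2" "t \<in> increasing_plane_trees n"
  shows "tree_weight (degree_weight k) t =
    (\<Prod>j=1..n. elem_sym (k + 1) (k + 2 - j) ^ degree_seq n t j)"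
proof -
  have "(\<Prod>d<n. degree_weight k d ^ num_of_degree d t) =
      (\<Prod>j=1..n. degree_weight k (j - 1) ^ num_of_degree (j - 1) t)"
    by (rule prod.reindex_bij_witness[of _ "\<lambda>j. j - 1" Suc]) auto
  also have "\<dots> = (\<Prod>j=1..n. elem_sym (k + 1) (k + 2 - j) ^ degree_seq n t j)"
  proof (rule prod.cong)
    fix j assume j: "j \<in> {1..n}"
    then have "k + 1 - (j - 1) = k + 2 - j" "j - 1 \<le> k + 1" using assms(1) by auto
    with j show "degree_weight k (j - 1) ^ num_of_degree (j - 1) t =
        elem_sym (k + 1) (k + 2 - j) ^ degree_seq n t j"
      by (simp add: degree_weight_def degree_seq_def)
  qed simp
  finally show ?thesis unfolding tree_weight_eq_prod[OF assms(2)] .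
qed

lemma tree_weight_sum_by_degree_seq:
  assumes "n \<ge> 2" "n \<le> k + 2"
  shows "(\<Sum>t\<in>increasing_plane_trees n. tree_weight (degree_weight k) t) =
    (\<Sum>i\<in>index_seqs n. of_nat (gamma_coeff k n i) * (\<Prod>j=1..n. elem_sym (k + 1) (k + 2 - j) ^ i j))"
proof -
  let ?T = "increasing_plane_trees n"
  let ?F = "\<lambda>i. \<Prod>j=1..n. elem_sym (k + 1) (k + 2 - j) ^ i j"
  have "(\<Sum>t\<in>?T. tree_weight (degree_weight k) t) = (\<Sum>t\<in>?T. ?F (degree_seq n t))"
    using assms(2) by (intro sum.cong refl tree_weight_eq_degree_seq_prod)
  also have "\<dots> = (\<Sum>i\<in>index_seqs n. \<Sum>t\<in>{t\<in>?T. degree_seq n t = i}. ?F (degree_seq n t))"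
    by (rule sum.group[symmetric])
      (use assms finite_increasing_plane_trees[of n] finite_index_seqs degree_seq_in_index_seqs in auto)
  also have "\<dots> = (\<Sum>i\<in>index_seqs n. of_nat (gamma_coeff k n i) * ?F i)"
    using assms(2) by (intro sum.cong refl) (simp add: gamma_coeff_eq)
  finally show ?thesis .
qed

section \<open>The expansion in elementary symmetric functions\<close>

theorem theorem28:
  fixes k n :: nat
  assumes "k \<ge> 1" and "n \<ge> 2" and "k \<ge> n - 2"
  shows "eulerian_poly k n =
    (\<Sum>i\<in>index_seqs n. of_nat (gamma_coeff k n i) * (\<Prod>j=1..n. elem_sym (k + 1) (k + 2 - j) ^ i j))"
proof -
  have "n \<ge> 1" "n \<le> k + 2" using assms by simp_all
  then show ?thesis
    using eulerian_poly_eq_grammar_deriv[of k n] tree_weight_sum[of n k]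
      tree_weight_sum_by_degree_seq[of n k] assms by argo
qed

end
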